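(* Let $G=\langle \mathcal X\mid\mathcal Q\mid\Phi\mid\mathcal R\rangle$ be a group given by an invariant finite $L$-presentation and let $\mathcal U\unlhd G$ be a normal subgroup of finite index which is weakly leaf-invariant. Then $\mathcal U$ is invariantly finitely $L$-presented.
   Context: A finite $L$-presentation $\langle \mathcal X\mid\mathcal Q\mid\Phi\mid\mathcal R\rangle$ consists of a finite alphabet $\mathcal X$, finite subsets $\mathcal Q,\mathcal R$ of the free group $F$ over $\mathcal X$, and a finite set $\Phi\subseteq\operatorname{End}(F)$. $\Phi^*$ denotes the free monoid on $\Phi$; its elements are words $\sigma=\sigma_1\cdots\sigma_n$ ($\sigma_i\in\Phi$), acting on $F$ as endomorphisms. Maps act from the right, so $\sigma\delta$ means first $\sigma$, then $\delta$; the empty word is the identity $\mathrm{id}$. The $L$-presentation defines the group $F/K$, where $K$ is the normal closure in $F$ of $\mathcal Q\cup\bigcup_{\sigma\in\Phi^*}\mathcal R^\sigma$. It is invariant if $K^\varphi\subseteq K$ for every $\varphi\in\Phi$; a group is invariantly finitely $L$-presented if it is isomorphic to a group defined by some invariant finite $L$-presentation. Let $\mathcal U\le G=F/K$ have finite index and let $UK\le F$ be its full preimage in $F$. Let $\varphi\colon F\to\operatorname{Sym}(UK\backslash F)$ be the permutation representation given by right multiplication on the right cosets of $UK$. For $\sigma\in\Phi^*$, $\sigma\varphi$ is the composition $g\mapsto (g^\sigma)^\varphi$. Fix a total ordering $\prec$ on $\Phi$ and extend it to the length-plus-(from the right)-lexicographic well-ordering on $\Phi^*$: $\sigma\prec\delta$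 if $\sigma$ is a shorter word than $\delta$, or if $\sigma=\sigma_1\cdots\sigma_n$ and $\delta=\delta_1\cdots\delta_n$ have the same length and there is $1\le k\le n$ with $\sigma_i=\delta_i$ for all $k<i\le n$ and $\sigma_k\prec\delta_k$. Let $V\subseteq\Phi^*$ be the finite set consisting, for each homomorphism in $\{\sigma\varphi:\sigma\in\Phi^*\}$, of the $\prec$-least $\sigma\in\Phi^*$ inducing it. For $\sigma,\delta\in\Phi^*$ write $\sigma\leadsto_\varphi\delta$ if there is a homomorphism $\pi\colon\operatorname{im}(\delta\varphi)\to\operatorname{im}(\sigma\varphi)$ with $\sigma\varphi=\delta\varphi\pi$ (first $\delta\varphi$, then $\pi$). The subgroup $\mathcal U$ is weakly leaf-invariant (with respect to the given $L$-presentation) if $\psi\delta\leadsto_\varphi\mathrm{id}$ for all $\psi\in\Phi$ and $\delta\in V$ with $\psi\delta\notin V$. *)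

theory Defs
  imports "HOL-Algebra.Coset" "HOL-Algebra.Bij"
begin

text \<open>A pair \<open>(x, True)\<close> stands for the generator \<open>x\<close>, and \<open>(x, False)\<close> for its formal
  inverse. The free group on \<open>X\<close> is carried by the freely reduced words over \<open>X\<close>.\<close>

type_synonym 'a word = "('a \<times> bool) list"

definition inv_letter :: "'a \<times> bool \<Rightarrow> 'a \<times> bool" where
  "inv_letter a = (fst a, \<not> snd a)"

definition reduced :: "'a word \<Rightarrow> bool" where
  "reduced w \<longleftrightarrow> successively (\<lambda>a b. b \<noteq> inv_letter a) w"

fun push_letter :: "'a \<times> bool \<Rightarrow> 'a word \<Rightarrow> 'a word" where
  "push_letter a [] = [a]"
| "push_letter a (b # w) = (if b = inv_letter a then w else a # b # w)"

definition free_group :: "'a set \<Rightarrow> 'a word monoid" where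
  "free_group X =
     \<lparr>carrier = {w \<in> lists (X \<times> UNIV). reduced w},
      mult = (\<lambda>u v. foldr push_letter u v),
      one = []\<rparr>"

lemma inv_letter_invol [simp]: "inv_letter (inv_letter a) = a"
  by (simp add: inv_letter_def)

lemma inv_letter_neq [simp]: "inv_letter a \<noteq> a" "a \<noteq> inv_letter a"
  by (auto simp: inv_letter_def prod_eq_iff)

lemma reduced_Nil [simp]: "reduced []"
  by (simp add: reduced_def)

lemma reduced_push: "reduced w \<Longrightarrow> reduced (push_letter a w)"
  by (cases w) (auto simp: reduced_def successively_Cons)

lemma reduced_foldr_push: "reduced v \<Longrightarrow> reduced (foldr push_letter u v)"
  by (induction u) (auto intro: reduced_push)

lemma push_inv_push: "reduced w \<Longrightarrow> push_letter (inv_letter a) (push_letter a w) = w"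
  by (cases w; cases "tl w") (auto simp: reduced_def successively_Cons)

lemma push_push_inv: "reduced w \<Longrightarrow> push_letter a (push_letter (inv_letter a) w) = w"
  using push_inv_push[of w "inv_letter a"] by simp

lemma foldr_push_assoc:
  assumes "reduced v" "reduced w"
  shows "foldr push_letter (foldr push_letter u v) w = foldr push_letter u (foldr push_letter v w)"
proof (induction u)
  case (Cons a u)
  have push: "foldr push_letter (push_letter a z) w = push_letter a (foldr push_letter z w)" for z
    by (cases z) (auto simp: push_push_inv reduced_foldr_push assms(2))
  show ?case by (simp add: push Cons)
qed simp

lemma foldr_push_Nil: "reduced u \<Longrightarrow> foldr push_letter u [] = u"
proof (induction u)
  case (Cons a u)
  then show ?case by (cases u) (auto simp: reduced_def successively_Cons)
qed simp

lemma foldr_push_lists: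
  "u \<in> lists A \<Longrightarrow> v \<in> lists A \<Longrightarrow> foldr push_letter u v \<in> lists A"
proof (induction u)
  case (Cons a u)
  then have "foldr push_letter u v \<in> lists A" "a \<in> A" by auto
  then show ?case by (cases "foldr push_letter u v") auto
qed simp

lemma foldr_push_inverse:
  "reduced v \<Longrightarrow> foldr push_letter (rev (map inv_letter u)) (foldr push_letter u v) = v"
  by (induction u) (auto simp: push_inv_push reduced_foldr_push)

lemma reduced_inverse: "reduced u \<Longrightarrow> reduced (rev (map inv_letter u))"
  by (auto simp: reduced_def successively_map elim!: successively_mono)

lemma group_free_group: "group (free_group X)"
proof (rule groupI)
  fix u assume u: "u \<in> carrier (free_group X)"
  let ?v = "rev (map inv_letter u)"
  have "?v \<in> carrier (free_group X)"
    using u by (fastforce simp: free_group_def reduced_inverse inv_letter_def)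
  moreover have "?v \<otimes>\<^bsub>free_group X\<^esub> u = \<one>\<^bsub>free_group X\<^esub>"
    using foldr_push_inverse[of "[]" u] u by (simp add: free_group_def foldr_push_Nil)
  ultimately show "\<exists>v\<in>carrier (free_group X). v \<otimes>\<^bsub>free_group X\<^esub> u = \<one>\<^bsub>free_group X\<^esub>"
    by blast
qed (auto simp: free_group_def reduced_foldr_push foldr_push_assoc foldr_push_lists
       simp del: in_lists_conv_set)

definition normal_closure :: "('g, 'm) monoid_scheme \<Rightarrow> 'g set \<Rightarrow> 'g set" where
  "normal_closure G S = \<Inter>{N. N \<lhd> G \<and> S \<subseteq> N}"

text \<open>Endomorphisms are taken to be undefined off the carrier, so that equality of HOL functions
  is equality of endomorphisms.\<close>

definition endomorphisms :: "('g, 'm) monoid_scheme \<Rightarrow> ('g \<Rightarrow> 'g) set" where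
  "endomorphisms G = hom G G \<inter> extensional (carrier G)"

record 'a L_presentation =
  alphabet :: "'a set"
  fixed_rels :: "'a word set"
  endos :: "('a word \<Rightarrow> 'a word) set"
  iter_rels :: "'a word set"

definition finite_L_presentation :: "'a L_presentation \<Rightarrow> bool" where
  "finite_L_presentation L \<longleftrightarrow>
     finite (alphabet L) \<and>
     finite (fixed_rels L) \<and> fixed_rels L \<subseteq> carrier (free_group (alphabet L)) \<and>
     finite (endos L) \<and> endos L \<subseteq> endomorphisms (free_group (alphabet L)) \<and>
     finite (iter_rels L) \<and> iter_rels L \<subseteq> carrier (free_group (alphabet L))"

text \<open>The free monoid on \<open>endos L\<close> is \<open>lists (endos L)\<close>. Maps act from the right: the head
  of the list is applied first.\<close>

definition act :: "('g \<Rightarrow> 'g) list \<Rightarrow> 'g \<Rightarrow> 'g" where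
  "act \<sigma> g = fold (\<lambda>\<psi> x. \<psi> x) \<sigma> g"

definition L_kernel :: "'a L_presentation \<Rightarrow> 'a word set" where
  "L_kernel L = normal_closure (free_group (alphabet L))
     (fixed_rels L \<union> (\<Union>\<sigma>\<in>lists (endos L). act \<sigma> ` iter_rels L))"

definition L_group :: "'a L_presentation \<Rightarrow> 'a word set monoid" where
  "L_group L = free_group (alphabet L) Mod L_kernel L"

definition invariant_L_presentation :: "'a L_presentation \<Rightarrow> bool" where
  "invariant_L_presentation L \<longleftrightarrow> (\<forall>\<psi>\<in>endos L. \<psi> ` L_kernel L \<subseteq> L_kernel L)"

text \<open>Alphabets are finite, so it is no restriction to draw the letters from \<^typ>\<open>nat\<close>.\<close>

definition invariantly_finitely_L_presented :: "('g, 'm) monoid_scheme \<Rightarrow> bool" where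
  "invariantly_finitely_L_presented G \<longleftrightarrow>
     (\<exists>L :: nat L_presentation.
        finite_L_presentation L \<and> invariant_L_presentation L \<and> G \<cong> L_group L)"


text \<open>The preimage of \<open>U\<close>, a set of cosets of the kernel, in the free group.\<close>

definition full_preimage :: "'a L_presentation \<Rightarrow> 'a word set set \<Rightarrow> 'a word set" where
  "full_preimage L U =
     {g \<in> carrier (free_group (alphabet L)). L_kernel L #>\<^bsub>free_group (alphabet L)\<^esub> g \<in> U}"

text \<open>Unlike in \<^const>\<open>BijGroup\<close>, permutations act from the right: \<open>f \<otimes> g\<close> is first \<open>f\<close>,
  then \<open>g\<close>. This is what makes right multiplication on right cosets a homomorphism.\<close>

definition sym_group :: "'b set \<Rightarrow> ('b \<Rightarrow> 'b) monoid" where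
  "sym_group S =
     \<lparr>carrier = Bij S, mult = (\<lambda>f g. compose S g f), one = (\<lambda>x\<in>S. x)\<rparr>"

definition coset_rep :: "('g, 'm) monoid_scheme \<Rightarrow> 'g set \<Rightarrow> 'g \<Rightarrow> 'g set \<Rightarrow> 'g set" where
  "coset_rep G H g = (\<lambda>C\<in>rcosets\<^bsub>G\<^esub> H. C #>\<^bsub>G\<^esub> g)"

text \<open>The homomorphism \<open>\<sigma>\<phi>\<close>, where \<open>\<phi>\<close> is the coset representation on the preimage of \<open>U\<close>.\<close>

definition word_rep ::
  "'a L_presentation \<Rightarrow> 'a word set set \<Rightarrow> ('a word \<Rightarrow> 'a word) list
     \<Rightarrow> 'a word \<Rightarrow> 'a word set \<Rightarrow> 'a word set" where
  "word_rep L U \<sigma> = (\<lambda>g\<in>carrier (free_group (alphabet L)).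
     coset_rep (free_group (alphabet L)) (full_preimage L U) (act \<sigma> g))"

definition rep_image ::
  "'a L_presentation \<Rightarrow> 'a word set set \<Rightarrow> ('a word \<Rightarrow> 'a word) list
     \<Rightarrow> ('a word set \<Rightarrow> 'a word set) monoid" where
  "rep_image L U \<sigma> =
     (sym_group (rcosets\<^bsub>free_group (alphabet L)\<^esub> (full_preimage L U)))
       \<lparr>carrier := word_rep L U \<sigma> ` carrier (free_group (alphabet L))\<rparr>"

definition leads_to ::
  "'a L_presentation \<Rightarrow> 'a word set set \<Rightarrow> ('a word \<Rightarrow> 'a word) list
     \<Rightarrow> ('a word \<Rightarrow> 'a word) list \<Rightarrow> bool" where
  "leads_to L U \<sigma> \<delta> \<longleftrightarrow>
     (\<exists>\<pi> \<in> hom (rep_image L U \<delta>) (rep_image L U \<sigma>).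
        \<forall>g\<in>carrier (free_group (alphabet L)). word_rep L U \<sigma> g = \<pi> (word_rep L U \<delta> g))"

definition word_order :: "('b \<times> 'b) set \<Rightarrow> ('b list \<times> 'b list) set" where
  "word_order r =
     {(\<sigma>, \<delta>). length \<sigma> < length \<delta> \<or>
        (length \<sigma> = length \<delta> \<and>
         (\<exists>k<length \<sigma>. (\<sigma> ! k, \<delta> ! k) \<in> r \<and> (\<forall>i. k < i \<and> i < length \<sigma> \<longrightarrow> \<sigma> ! i = \<delta> ! i)))}"

lemma lex_snoc:
  "length xs = length ys \<Longrightarrow>
     (xs @ [a], ys @ [b]) \<in> lex r \<longleftrightarrow> (xs, ys) \<in> lex r \<or> xs = ys \<and> (a, b) \<in> r"
  by (induction xs ys rule: list_induct2) auto

lemma word_order_eq_lenlex: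
  "word_order r = inv_image (lenlex r) rev"
proof -
  have *: "(\<exists>k<length \<sigma>. (\<sigma> ! k, \<delta> ! k) \<in> r \<and> (\<forall>i. k < i \<and> i < length \<sigma> \<longrightarrow> \<sigma> ! i = \<delta> ! i))
      \<longleftrightarrow> (rev \<sigma>, rev \<delta>) \<in> lex r" if "length \<sigma> = length \<delta>" for \<sigma> \<delta>
    using that
  proof (induction \<sigma> \<delta> rule: list_induct2)
    case (Cons x xs y ys)
    have shift: "(\<forall>i. Suc k < i \<and> i < Suc n \<longrightarrow> Q i) \<longleftrightarrow> (\<forall>i. k < i \<and> i < n \<longrightarrow> Q (Suc i))"
      "(\<forall>i. 0 < i \<and> i < Suc n \<longrightarrow> Q i) \<longleftrightarrow> (\<forall>i<n. Q (Suc i))" for k n and Q :: "nat \<Rightarrow> bool"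
      by (metis Suc_less_eq Suc_less_eq2) (metis Suc_less_eq gr0_conv_Suc)
    have "(\<exists>k<length (x # xs). ((x # xs) ! k, (y # ys) ! k) \<in> r \<and>
          (\<forall>i. k < i \<and> i < length (x # xs) \<longrightarrow> (x # xs) ! i = (y # ys) ! i))
        \<longleftrightarrow> (rev xs, rev ys) \<in> lex r \<or> xs = ys \<and> (x, y) \<in> r"
      unfolding Cons.IH[symmetric] using Cons.hyps
      by (simp only: length_Cons Ex_less_Suc2 shift nth_Cons_0 nth_Cons_Suc)
         (auto simp: list_eq_iff_nth_eq)
    then show ?case using Cons.hyps by (simp add: lex_snoc)
  qed simp
  then show ?thesis
    unfolding word_order_def lenlex_conv inv_image_def by fastforce
qed

text \<open>The set \<open>V\<close> of least words inducing the homomorphisms \<open>\<sigma>\<phi>\<close>.\<close>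

definition least_words ::
  "'a L_presentation \<Rightarrow> (('a word \<Rightarrow> 'a word) \<times> ('a word \<Rightarrow> 'a word)) set
     \<Rightarrow> 'a word set set \<Rightarrow> ('a word \<Rightarrow> 'a word) list set" where
  "least_words L r U =
     {\<sigma> \<in> lists (endos L). \<forall>\<delta>\<in>lists (endos L).
        word_rep L U \<delta> = word_rep L U \<sigma> \<longrightarrow> \<delta> = \<sigma> \<or> (\<sigma>, \<delta>) \<in> word_order r}"

definition weakly_leaf_invariant ::
  "'a L_presentation \<Rightarrow> (('a word \<Rightarrow> 'a word) \<times> ('a word \<Rightarrow> 'a word)) set
     \<Rightarrow> 'a word set set \<Rightarrow> bool" where
  "weakly_leaf_invariant L r U \<longleftrightarrow>
     (\<forall>\<psi>\<in>endos L. \<forall>\<delta>\<in>least_words L r U.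
        \<psi> # \<delta> \<notin> least_words L r U \<longrightarrow> leads_to L U (\<psi> # \<delta>) [])"

end

theory Submission
  imports Defs
begin

text \<open>Let \<open>F\<close> be the free group, \<open>K\<close> the kernel and \<open>H\<close> the full preimage of \<open>U\<close>, a normal subgroup of
  finite index. Cutting a word over \<open>\<Phi>\<close> again and again at its longest suffix in \<open>V\<close> writes it as
  some \<open>v \<in> V\<close> followed by words \<open>\<psi>\<delta> \<notin> V\<close> with \<open>\<psi> \<in> \<Phi>\<close>, \<open>\<delta> \<in> V\<close>; weak leaf-invariance says that
  each \<open>\<psi>\<delta>\<close> maps \<open>H\<close> into itself. Hence \<open>K\<close> is the normal closure in \<open>H\<close> of the images of the finite
  set of all \<open>v(q)\<close>, \<open>v(r)\<close> under the monoid generated by finitely many endomorphisms of \<open>H\<close>: the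
  \<open>\<psi>\<delta>\<close> and the conjugations by letters of \<open>F\<close>, which make the normal closure in \<open>H\<close> normal in \<open>F\<close>.
  No free basis of \<open>H\<close> is needed: Reidemeister rewriting makes \<open>H\<close> a retract of the free group
  on pairs of a coset and a letter, and this suffices to turn the description of \<open>K\<close> into an
  \<open>L\<close>-presentation of \<open>H / K\<close>.\<close>

subsection \<open>Normal closures and orbits of endomorphisms\<close>

lemma normal_vimage:
  assumes "group_hom G H h" "N \<lhd> H"
  shows "{g \<in> carrier G. h g \<in> N} \<lhd> G"
proof -
  interpret group_hom G H h by fact
  interpret N: normal N H by fact
  show ?thesis
    unfolding G.normal_inv_iff
    by (auto intro!: G.subgroupI exI[of _ "\<one>\<^bsub>G\<^esub>"] simp: N.inv_op_closed2)
qed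

lemma normal_normal_closure:
  assumes "group G" "S \<subseteq> carrier G"
  shows "normal_closure G S \<lhd> G"
proof -
  interpret group G by fact
  have "carrier G \<lhd> G"
    by (simp add: normal_inv_iff subgroup_self)
  then have "{N. N \<lhd> G \<and> S \<subseteq> N} \<noteq> {}" using assms(2) by blast
  then have "subgroup (normal_closure G S) G"
    unfolding normal_closure_def by (intro subgroups_Inter) (auto simp: normal_inv_iff)
  then show ?thesis
    unfolding normal_inv_iff by (auto simp: normal_closure_def normal.inv_op_closed2)
qed

lemma normal_closure_superset: "S \<subseteq> normal_closure G S"
  by (auto simp: normal_closure_def)

lemma normal_closure_least: "N \<lhd> G \<Longrightarrow> S \<subseteq> N \<Longrightarrow> normal_closure G S \<subseteq> N"
  by (auto simp: normal_closure_def)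

text \<open>The preimage of \<open>N\<close> under \<open>h\<close> is normal in \<open>G\<close>
  and contains \<open>S\<close>, hence contains the normal closure. Elements of a normal closure
  thus never have to be written as products of conjugates.\<close>

lemma normal_closure_image_subset:
  assumes "group_hom G H h" "N \<lhd> H" "S \<subseteq> carrier G" "h ` S \<subseteq> N"
  shows "h ` normal_closure G S \<subseteq> N"
proof -
  have "normal_closure G S \<subseteq> {g \<in> carrier G. h g \<in> N}"
    using assms by (intro normal_closure_least normal_vimage) auto
  then show ?thesis by auto
qed

section \<open>Words of endomorphisms and their orbits\<close>

lemma act_simps [simp]: "act [] g = g" "act (\<psi> # \<sigma>) g = act \<sigma> (\<psi> g)"
  "act (\<sigma> @ \<tau>) g = act \<tau> (act \<sigma> g)"
  by (simp_all add: act_def)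

lemma act_closed:
  "(\<And>\<psi> x. \<psi> \<in> \<Phi> \<Longrightarrow> x \<in> S \<Longrightarrow> \<psi> x \<in> S) \<Longrightarrow> \<sigma> \<in> lists \<Phi> \<Longrightarrow> x \<in> S \<Longrightarrow> act \<sigma> x \<in> S"
  by (induction \<sigma> arbitrary: x) auto

lemma act_hom: "\<sigma> \<in> lists \<Phi> \<Longrightarrow> \<Phi> \<subseteq> hom G G \<Longrightarrow> act \<sigma> \<in> hom G G"
proof (induction \<sigma>)
  case (Cons \<psi> \<sigma>)
  then have "act \<sigma> \<circ> \<psi> \<in> hom G G" by (intro hom_compose) auto
  then show ?case by (simp add: comp_def)
qed (simp add: hom_def)

lemma orbit_subset:
  assumes "\<Phi> \<subseteq> hom A A" "R \<subseteq> carrier A"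
  shows "(\<Union>\<sigma>\<in>lists \<Phi>. act \<sigma> ` R) \<subseteq> carrier A"
proof -
  have "\<phi> x \<in> carrier A" if "\<phi> \<in> \<Phi>" "x \<in> carrier A" for \<phi> x
    using that assms(1) by (auto simp: hom_def)
  then show ?thesis using act_closed[of \<Phi> "carrier A"] assms(2) by blast
qed

text \<open>Maps act from the right, so applying \<phi> after \<sigma> is the action of the word
  \<open>\<sigma> @ [\<phi>]\<close>.\<close>

lemma orbit_invariant:
  assumes "\<phi> \<in> \<Phi>"
  shows "\<phi> ` (\<Union>\<sigma>\<in>lists \<Phi>. act \<sigma> ` R) \<subseteq> (\<Union>\<sigma>\<in>lists \<Phi>. act \<sigma> ` R)"
proof -
  have "\<phi> (act \<sigma> x) = act (\<sigma> @ [\<phi>]) x" "\<sigma> @ [\<phi>] \<in> lists \<Phi>" if "\<sigma> \<in> lists \<Phi>" for \<sigma> x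
    using that assms by auto
  then show ?thesis by blast
qed

lemma normal_closure_orbit_invariant:
  assumes "group A" "\<Phi> \<subseteq> hom A A" "R \<subseteq> carrier A" "\<phi> \<in> \<Phi>"
  shows "\<phi> ` normal_closure A (\<Union>\<sigma>\<in>lists \<Phi>. act \<sigma> ` R)
    \<subseteq> normal_closure A (\<Union>\<sigma>\<in>lists \<Phi>. act \<sigma> ` R)"
proof (rule normal_closure_image_subset)
  show "group_hom A A \<phi>"
    using assms by (auto simp: group_hom_def group_hom_axioms_def)
  show "(\<Union>\<sigma>\<in>lists \<Phi>. act \<sigma> ` R) \<subseteq> carrier A"
    by (rule orbit_subset[OF assms(2,3)])
  then show "normal_closure A (\<Union>\<sigma>\<in>lists \<Phi>. act \<sigma> ` R) \<lhd> A"
    by (rule normal_normal_closure[OF assms(1)])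
  show "\<phi> ` (\<Union>\<sigma>\<in>lists \<Phi>. act \<sigma> ` R)
      \<subseteq> normal_closure A (\<Union>\<sigma>\<in>lists \<Phi>. act \<sigma> ` R)"
    by (rule order_trans[OF orbit_invariant[OF assms(4)] normal_closure_superset])
qed

subsection \<open>Free groups and their retracts\<close>

lemma letter_in_free_group: "[a] \<in> carrier (free_group X) \<longleftrightarrow> fst a \<in> X"
  by (cases a) (auto simp: free_group_def reduced_def)

lemma Cons_in_free_groupD:
  assumes "a # w \<in> carrier (free_group X)"
  shows "fst a \<in> X" "w \<in> carrier (free_group X)" "a # w = [a] \<otimes>\<^bsub>free_group X\<^esub> w"
  using assms by (cases w; force simp: free_group_def reduced_def)+

lemma one_free_group: "\<one>\<^bsub>free_group X\<^esub> = []"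
  by (simp add: free_group_def)

lemma inv_letter_free_group:
  "fst a \<in> X \<Longrightarrow> inv\<^bsub>free_group X\<^esub> [a] = [inv_letter a]"
  by (intro group.inv_equality[OF group_free_group])
     (auto simp: letter_in_free_group, auto simp: free_group_def inv_letter_def)

lemma free_group_induct [consumes 1, case_names one letter]:
  assumes "w \<in> carrier (free_group X)" "P []"
    and "\<And>a w. fst a \<in> X \<Longrightarrow> w \<in> carrier (free_group X) \<Longrightarrow> P w \<Longrightarrow> P ([a] \<otimes>\<^bsub>free_group X\<^esub> w)"
  shows "P w"
  using assms(1)
proof (induction w)
  case (Cons a w)
  then show ?case using Cons_in_free_groupD[OF Cons.prems] assms(3) by metis
qed (rule assms(2))

lemma free_group_subgroup_eq:
  assumes "subgroup S (free_group X)" "\<And>x. x \<in> X \<Longrightarrow> [(x, True)] \<in> S"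
    and "w \<in> carrier (free_group X)"
  shows "w \<in> S"
proof -
  interpret S: subgroup S "free_group X" by fact
  have letter: "[a] \<in> S" if "fst a \<in> X" for a
  proof (cases a)
    case (Pair x b)
    have "inv\<^bsub>free_group X\<^esub> [(x, True)] \<in> S" 
      using that Pair assms(2) by auto
    then have "[(x, False)] \<in> S"
      using that Pair by (simp add: inv_letter_free_group inv_letter_def)
    then show ?thesis using that Pair assms(2) by (cases b) auto
  qed
  from assms(3) show ?thesis
    by (induction rule: free_group_induct)
       (auto simp: letter S.one_closed[unfolded one_free_group])
qed

text \<open>The equalizer of two homomorphisms is a subgroup, and a subgroup containing the
  generators is the whole free group.\<close>

lemma free_group_hom_eq:
  assumes "f \<in> hom (free_group X) G" "g \<in> hom (free_group X) G" "group G"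
    and "\<And>x. x \<in> X \<Longrightarrow> f [(x, True)] = g [(x, True)]"
    and "w \<in> carrier (free_group X)"
  shows "f w = g w"
proof -
  interpret f: group_hom "free_group X" G f
    using assms by (simp add: group_hom_def group_hom_axioms_def group_free_group)
  interpret g: group_hom "free_group X" G g
    using assms by (simp add: group_hom_def group_hom_axioms_def group_free_group)
  have "subgroup {w \<in> carrier (free_group X). f w = g w} (free_group X)"
    by (rule f.G.subgroupI) (auto intro!: exI[of _ "\<one>\<^bsub>free_group X\<^esub>"])
  from free_group_subgroup_eq[OF this _ assms(5)] show ?thesis
    using assms(4) by (auto simp: letter_in_free_group)
qed

text \<open>The relations \<open>y\<^sup>-\<^sup>1 s (\<pi> y)\<close> present the retract \<open>A\<close>, and \<open>s \<circ> \<phi> \<circ> \<pi>\<close> lifts an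
  endomorphism \<open>\<phi>\<close> of \<open>A\<close> to the free group.\<close>

lemma retract_invariantly_finitely_L_presented:
  fixes Y :: "nat set" and A :: "('g, 'm) monoid_scheme"
  assumes "finite Y" "group A" "\<pi> \<in> hom (free_group Y) A" "s \<in> hom A (free_group Y)"
    and retract: "\<And>g. g \<in> carrier A \<Longrightarrow> \<pi> (s g) = g"
    and "finite \<Phi>" "\<Phi> \<subseteq> hom A A" "finite R" "R \<subseteq> carrier A"
  shows "invariantly_finitely_L_presented
    (A Mod normal_closure A (\<Union>\<sigma>\<in>lists \<Phi>. act \<sigma> ` R))"
proof -
  let ?F = "free_group Y"
  interpret F: group ?F by (rule group_free_group)
  interpret A: group A by fact
  interpret pi: group_hom ?F A \<pi> by unfold_locales fact
  interpret s: group_hom A ?F s by unfold_locales fact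
  define O_A where "O_A = (\<Union>\<sigma>\<in>lists \<Phi>. act \<sigma> ` R)"
  define N where "N = normal_closure A O_A"
  \<comment> \<open>The restriction makes the lift extensional, as \<open>endomorphisms\<close>
    demands.\<close>
  define lift where "lift \<phi> = restrict (s \<circ> \<phi> \<circ> \<pi>) (carrier ?F)" for \<phi>
  define Q where "Q = (\<lambda>y. inv\<^bsub>?F\<^esub> [(y, True)] \<otimes>\<^bsub>?F\<^esub> s (\<pi> [(y, True)])) ` Y"
  define O_F where "O_F = (\<Union>\<sigma>\<in>lists (lift ` \<Phi>). act \<sigma> ` s ` R)"
  define L where "L = \<lparr>alphabet = Y, fixed_rels = Q, endos = lift ` \<Phi>, iter_rels = s ` R\<rparr>"
  define M where "M = L_kernel L"
  have hom\<Phi>: "group_hom A A \<phi>" if "\<phi> \<in> \<Phi>" for \<phi>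
    using that assms(7) by unfold_locales auto
  note \<Phi>_closed = group_hom.hom_closed[OF hom\<Phi>]
  have lift: "group_hom ?F ?F (lift \<phi>)" "lift \<phi> \<in> endomorphisms ?F" if "\<phi> \<in> \<Phi>" for \<phi>
  proof -
    have "s \<circ> \<phi> \<circ> \<pi> \<in> hom ?F ?F"
      using that assms(3,4,7) by (intro hom_compose[of _ _ A]) auto
    then have "lift \<phi> \<in> hom ?F ?F" unfolding lift_def by (rule F.hom_restrict) simp
    then show "lift \<phi> \<in> endomorphisms ?F" "group_hom ?F ?F (lift \<phi>)"
      by (auto simp: endomorphisms_def lift_def) unfold_locales
  qed
  have lift_s: "lift \<phi> (s g) = s (\<phi> g)" and pi_lift: "x \<in> carrier ?F \<Longrightarrow> \<pi> (lift \<phi> x) = \<phi> (\<pi> x)"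
    if "\<phi> \<in> \<Phi>" "g \<in> carrier A" for \<phi> g x
    using that by (auto simp: lift_def retract \<Phi>_closed)
  have O_A: "O_A \<subseteq> carrier A"
    unfolding O_A_def by (rule orbit_subset) fact+
  have O_F: "O_F \<subseteq> carrier ?F"
    unfolding O_F_def using assms(9) lift(2)
    by (intro orbit_subset) (auto simp: endomorphisms_def)
  have Q: "Q \<subseteq> carrier ?F"
    unfolding Q_def by (auto simp: letter_in_free_group)
  have M_eq: "M = normal_closure ?F (Q \<union> O_F)"
    by (simp add: M_def L_kernel_def L_def O_F_def)
  have N: "N \<lhd> A" unfolding N_def by (intro normal_normal_closure O_A assms)
  have M: "M \<lhd> ?F" unfolding M_eq using Q O_F by (intro normal_normal_closure F.is_group) auto
  interpret N: normal N A by (rule N)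
  interpret M: normal M ?F by (rule M)
  have N_\<Phi>: "\<phi> ` N \<subseteq> N" if "\<phi> \<in> \<Phi>" for \<phi>
    unfolding N_def O_A_def by (rule normal_closure_orbit_invariant) (fact assms that)+
  have M_lift: "lift \<phi> ` M \<subseteq> M" if \<phi>: "\<phi> \<in> \<Phi>" for \<phi>
  proof -
    interpret l: group_hom ?F ?F "lift \<phi>" by (rule lift(1)[OF \<phi>])
    have "lift \<phi> ` O_F \<subseteq> O_F"
      unfolding O_F_def using \<phi> by (intro orbit_invariant) auto
    moreover have "lift \<phi> g = \<one>\<^bsub>?F\<^esub>" if "g \<in> Q" for g
    proof -
      from that obtain y where y: "y \<in> Y" "g = inv\<^bsub>?F\<^esub> [(y, True)] \<otimes>\<^bsub>?F\<^esub> s (\<pi> [(y, True)])"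
        unfolding Q_def by blast
      have c: "[(y, True)] \<in> carrier ?F" using y by (simp add: letter_in_free_group)
      \<comment> \<open>Since \<pi> undoes \<open>s\<close>, the lift takes the same value on
        \<open>y\<close> and on \<open>s (\<pi> y)\<close>; it therefore sends the relators in
        \<open>Q\<close> to the unit and not merely into \<open>M\<close>.\<close>
      have "lift \<phi> (s (\<pi> [(y, True)])) = lift \<phi> [(y, True)]"
        using c by (simp add: lift_s \<phi>) (simp add: lift_def)
      then show ?thesis using c l.hom_closed[OF c] by (simp add: y(2) F.l_inv)
    qed
    ultimately have "lift \<phi> ` (Q \<union> O_F) \<subseteq> M"
      using normal_closure_superset[of "Q \<union> O_F" ?F] M.one_closed unfolding M_eq[symmetric] by auto
    then show ?thesis
      using M Q O_F unfolding M_eq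
      by (intro normal_closure_image_subset[OF l.group_hom_axioms]) auto
  qed
  have pi_M: "\<pi> ` M \<subseteq> N"
  proof -
    have "\<pi> g \<in> N" if "g \<in> Q" for g
    proof -
      from that obtain y where y: "y \<in> Y" "g = inv\<^bsub>?F\<^esub> [(y, True)] \<otimes>\<^bsub>?F\<^esub> s (\<pi> [(y, True)])"
        unfolding Q_def by blast
      have "[(y, True)] \<in> carrier ?F" using y by (simp add: letter_in_free_group)
      then show ?thesis by (simp add: y(2) retract)
    qed
    moreover have "O_F \<subseteq> {x \<in> carrier ?F. \<pi> x \<in> N}"
    proof -
      have "R \<subseteq> O_A" unfolding O_A_def by (auto intro!: bexI[of _ "[]"])
      then have "s x \<in> {x \<in> carrier ?F. \<pi> x \<in> N}" if "x \<in> R" for x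
        using that O_A normal_closure_superset[of O_A A] by (auto simp: N_def retract)
      \<comment> \<open>The map \<pi> intertwines \<open>lift \<phi>\<close> with \<phi>, and
        \<open>N\<close> is \<phi>-invariant, so the preimage of \<open>N\<close> is closed under
        all lifts. The unit serves as the element \<open>g\<close> of \<open>A\<close> that
        \<open>pi_lift\<close> asks for.\<close>
      moreover have "lift \<phi> x \<in> {x \<in> carrier ?F. \<pi> x \<in> N}"
        if "x \<in> {x \<in> carrier ?F. \<pi> x \<in> N}" "\<phi> \<in> \<Phi>" for x \<phi>
        using that N_\<Phi>[of \<phi>] group_hom.hom_closed[OF lift(1)[of \<phi>]]
          pi_lift[of \<phi> "\<one>\<^bsub>A\<^esub>" x] by auto
      ultimately show ?thesis
        unfolding O_F_def using act_closed[of "lift ` \<Phi>" "{x \<in> carrier ?F. \<pi> x \<in> N}"] by blast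
    qed
    ultimately show ?thesis
      unfolding M_eq using Q O_F
      by (intro normal_closure_image_subset[OF pi.group_hom_axioms N]) auto
  qed
  \<comment> \<open>Dually, \<open>s\<close> intertwines \<phi> with \<open>lift \<phi>\<close>, so
    the elements that \<open>s\<close> sends into \<open>M\<close> contain the whole orbit of
    \<open>R\<close>.\<close>
  have s_N: "s ` N \<subseteq> M"
  proof -
    have "x \<in> {x \<in> carrier A. s x \<in> M}" if "x \<in> R" for x
    proof -
      have "s x \<in> O_F" using that unfolding O_F_def by (auto intro!: bexI[of _ "[]"])
      then show ?thesis
        using that assms(9) normal_closure_superset[of "Q \<union> O_F" ?F] by (auto simp: M_eq)
    qed
    moreover have "\<phi> x \<in> {x \<in> carrier A. s x \<in> M}"
      if "\<phi> \<in> \<Phi>" "x \<in> {x \<in> carrier A. s x \<in> M}" for \<phi> x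
      using that M_lift[of \<phi>] lift_s[of \<phi> x] \<Phi>_closed by auto
    ultimately have "O_A \<subseteq> {x \<in> carrier A. s x \<in> M}"
      unfolding O_A_def using act_closed[of \<Phi> "{x \<in> carrier A. s x \<in> M}"] by blast
    then show ?thesis
      unfolding N_def by (intro normal_closure_image_subset[OF s.group_hom_axioms M O_A]) auto
  qed
  \<comment> \<open>Modulo \<open>M\<close> the map \<open>s \<circ> \<pi>\<close> is the identity:
    both sides are homomorphisms in \<open>g\<close>, and the relators in \<open>Q\<close> say that
    they agree on the generators.\<close>
  have coset: "M #>\<^bsub>?F\<^esub> g = M #>\<^bsub>?F\<^esub> s (\<pi> g)" if "g \<in> carrier ?F" for g
  proof (rule free_group_hom_eq[OF M.r_coset_hom_Mod _ M.factorgroup_is_group _ that])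
    have "(\<lambda>g. M #>\<^bsub>?F\<^esub> g) \<circ> (s \<circ> \<pi>) \<in> hom ?F (?F Mod M)"
      by (intro hom_compose[of _ _ ?F] hom_compose[of _ _ A] assms M.r_coset_hom_Mod)
    then show "(\<lambda>g. M #>\<^bsub>?F\<^esub> s (\<pi> g)) \<in> hom ?F (?F Mod M)" by (simp add: comp_def)
    fix y assume "y \<in> Y"
    then have y: "[(y, True)] \<in> carrier ?F" by (simp add: letter_in_free_group)
    have "inv\<^bsub>?F\<^esub> [(y, True)] \<otimes>\<^bsub>?F\<^esub> s (\<pi> [(y, True)]) \<in> M"
      using \<open>y \<in> Y\<close> normal_closure_superset[of "Q \<union> O_F" ?F] by (auto simp: M_eq Q_def)
    from M.inv_op_closed2[OF y this]
    have "s (\<pi> [(y, True)]) \<otimes>\<^bsub>?F\<^esub> inv\<^bsub>?F\<^esub> [(y, True)] \<in> M"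
      using y by (simp add: F.m_assoc[symmetric])
    then have "s (\<pi> [(y, True)]) \<in> M #>\<^bsub>?F\<^esub> [(y, True)]"
      using y M.rcos_module_rev[OF F.is_group] by simp
    then show "M #>\<^bsub>?F\<^esub> [(y, True)] = M #>\<^bsub>?F\<^esub> s (\<pi> [(y, True)])"
      using F.repr_independence y M.subgroup_axioms by blast
  qed
  \<comment> \<open>So \<open>M\<close> is the full preimage of \<open>N\<close> under \<pi>, that
    is, the kernel of the composite from the free group over \<open>A\<close> onto
    \<open>A Mod N\<close>. The first isomorphism theorem then applies.\<close>
  have M_pi: "g \<in> M \<longleftrightarrow> \<pi> g \<in> N" if g: "g \<in> carrier ?F" for g
  proof
    assume "\<pi> g \<in> N"
    then have "s (\<pi> g) \<in> M" using s_N by auto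
    then have "M #>\<^bsub>?F\<^esub> g = M" using coset[OF g] F.coset_join2 M.subgroup_axioms g by simp
    then show "g \<in> M" using F.rcos_self[OF g M.subgroup_axioms] by simp
  qed (use pi_M in auto)
  let ?h = "\<lambda>g. N #>\<^bsub>A\<^esub> \<pi> g"
  have "(\<lambda>g. N #>\<^bsub>A\<^esub> g) \<circ> \<pi> \<in> hom ?F (A Mod N)"
    by (intro hom_compose[of _ _ A] assms N.r_coset_hom_Mod)
  then interpret h: group_hom ?F "A Mod N" ?h
    using N.factorgroup_is_group
    by (simp add: group_hom_def group_hom_axioms_def comp_def group_free_group)
  have "kernel ?F (A Mod N) ?h = M"
  proof -
    have *: "N #>\<^bsub>A\<^esub> x = N \<longleftrightarrow> x \<in> N" if "x \<in> carrier A" for x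
      using A.coset_join1[OF _ that N.subgroup_axioms] A.coset_join2[OF that N.subgroup_axioms]
      by blast
    have "N #>\<^bsub>A\<^esub> \<pi> g = N \<longleftrightarrow> g \<in> M" if "g \<in> carrier ?F" for g
      unfolding M_pi[OF that] using that by (intro * pi.hom_closed)
    then have "kernel ?F (A Mod N) ?h = {g \<in> carrier ?F. g \<in> M}"
      unfolding kernel_def one_FactGroup by (intro Collect_cong conj_cong) (rule refl)
    also have "\<dots> = M" using M.subset by blast
    finally show ?thesis .
  qed
  moreover have "?h ` carrier ?F = carrier (A Mod N)"
  proof -
    have "\<pi> ` carrier ?F = carrier A"
    proof
      show "carrier A \<subseteq> \<pi> ` carrier ?F"
        using retract s.hom_closed by (metis image_eqI subsetI)
    qed auto
    then have "(\<lambda>g. N #>\<^bsub>A\<^esub> g) ` \<pi> ` carrier ?F = carrier (A Mod N)"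
      by (simp add: carrier_FactGroup)
    then show ?thesis by (simp add: image_image)
  qed
  ultimately have "?F Mod M \<cong> A Mod N" using h.FactGroup_iso by simp
  then have "A Mod N \<cong> L_group L"
    using group.iso_sym[OF M.factorgroup_is_group] by (simp add: L_group_def M_def L_def)
  moreover have "finite_L_presentation L"
    using assms(1,6,8,9) lift(2) Q by (auto simp: finite_L_presentation_def L_def Q_def)
  moreover have "invariant_L_presentation L"
    using M_lift unfolding M_def by (auto simp: invariant_L_presentation_def L_def)
  ultimately show ?thesis
    unfolding invariantly_finitely_L_presented_def N_def O_A_def by blast
qed

subsection \<open>Reidemeister rewriting\<close>

definition free_lift :: "('g, 'm) monoid_scheme \<Rightarrow> ('a \<Rightarrow> 'g) \<Rightarrow> 'a word \<Rightarrow> 'g" where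
  "free_lift G f w =
     foldr (\<lambda>a g. (if snd a then f (fst a) else inv\<^bsub>G\<^esub> f (fst a)) \<otimes>\<^bsub>G\<^esub> g) w \<one>\<^bsub>G\<^esub>"

text \<open>Induction on the left factor reduces multiplicativity to pushing one letter. If that
  letter cancels in the word, its value cancels against the value of the inverse letter in
  \<open>G\<close>.\<close>

lemma free_lift_hom:
  assumes "group G" "\<And>x. x \<in> X \<Longrightarrow> f x \<in> carrier G"
  shows "free_lift G f \<in> hom (free_group X) G"
proof -
  interpret group G by fact
  let ?l = "\<lambda>a. if snd a then f (fst a) else inv\<^bsub>G\<^esub> f (fst a)"
  have l: "?l a \<in> carrier G" if "fst a \<in> X" for a using that assms(2) by auto
  have closed: "free_lift G f w \<in> carrier G" if "w \<in> carrier (free_group X)" for w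
    using that
  proof (induction w)
    case (Cons a w)
    then show ?case using Cons_in_free_groupD(1,2)[OF Cons.prems] l[of a] by (simp add: free_lift_def)
  qed (simp add: free_lift_def)
  have push: "free_lift G f (push_letter a w) = ?l a \<otimes>\<^bsub>G\<^esub> free_lift G f w"
    if a: "fst a \<in> X" and w: "w \<in> carrier (free_group X)" for a w
  proof (cases "\<exists>v. w = inv_letter a # v")
    case True
    then obtain v where v: "w = inv_letter a # v" by blast
    have "free_lift G f v \<in> carrier G" using w Cons_in_free_groupD(2) closed unfolding v by blast
    then show ?thesis
      using a l[OF a] assms(2)
      by (auto simp: v free_lift_def inv_letter_def m_assoc[symmetric])
  next
    case False
    then have "push_letter a w = a # w" by (cases w) auto
    then show ?thesis by (simp add: free_lift_def)
  qed
  have "free_lift G f (u \<otimes>\<^bsub>free_group X\<^esub> v) = free_lift G f u \<otimes>\<^bsub>G\<^esub> free_lift G f v"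
    if "u \<in> carrier (free_group X)" and v: "v \<in> carrier (free_group X)" for u v
    using that(1)
  proof (induction rule: free_group_induct)
    case one
    then show ?case using closed[OF v] by (simp add: free_group_def free_lift_def)
  next
    case (letter a w)
    interpret F: group "free_group X" by (rule group_free_group)
    have mult_letter: "[a] \<otimes>\<^bsub>free_group X\<^esub> z = push_letter a z" for z
      by (simp add: free_group_def)
    have "([a] \<otimes>\<^bsub>free_group X\<^esub> w) \<otimes>\<^bsub>free_group X\<^esub> v
        = push_letter a (w \<otimes>\<^bsub>free_group X\<^esub> v)"
      using letter v F.m_assoc[of "[a]" w v] by (simp add: letter_in_free_group mult_letter)
    then show ?case
      using letter v l[of a] closed by (simp add: push mult_letter m_assoc)
  qed
  then show ?thesis using closed by (simp add: hom_def)
qed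

lemma free_lift_letter:
  assumes "group G" "f x \<in> carrier G"
  shows "free_lift G f [(x, True)] = f x"
proof -
  interpret group G by fact
  show ?thesis using assms by (simp add: free_lift_def)
qed

text \<open>Reidemeister rewriting: reading a word while moving through the states of an action \<open>\<delta>\<close> of
  the letters, a generator \<open>x\<close> read in state \<open>c\<close> is output as \<open>e (c, x)\<close>; an inverse letter
  traverses its edge backwards, so it is labelled by the target state.\<close>

primrec rewrite ::
  "('c \<Rightarrow> 'a \<times> bool \<Rightarrow> 'c) \<Rightarrow> ('c \<times> 'a \<Rightarrow> 'b) \<Rightarrow> 'c \<Rightarrow> 'a word \<Rightarrow> 'b word" where
  "rewrite \<delta> e c [] = []"
| "rewrite \<delta> e c (a # w) =
     push_letter (e (if snd a then c else \<delta> c a, fst a), snd a) (rewrite \<delta> e (\<delta> c a) w)"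

lemma reduced_rewrite: "reduced (rewrite \<delta> e c w)"
  by (induction w arbitrary: c) (auto intro: reduced_push)

text \<open>This makes rewriting compatible with free reduction. An edge traversed and at once
  traversed back is labelled by the same state both times, so the two output letters are formal
  inverses and cancel as well.\<close>

lemma rewrite_push_letter:
  assumes "\<delta> (\<delta> c a) (inv_letter a) = c"
  shows "rewrite \<delta> e c (push_letter a w) = rewrite \<delta> e c (a # w)"
proof (cases "\<exists>v. w = inv_letter a # v")
  case True
  then obtain v where v: "w = inv_letter a # v" by blast
  let ?l = "(e (if snd a then c else \<delta> c a, fst a), snd a)"
  have "rewrite \<delta> e c (a # w) = push_letter ?l (push_letter (inv_letter ?l) (rewrite \<delta> e c v))"
    using assms by (simp add: v) (simp add: inv_letter_def)
  then show ?thesis by (simp add: v push_push_inv[OF reduced_rewrite])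
next
  case False
  then have "push_letter a w = a # w" by (cases w) auto
  then show ?thesis by simp
qed

text \<open>The states are the right cosets of \<open>H\<close> under right multiplication, and
  \<open>Y\<close> numbers the pairs of a coset and a generator. The map \<open>s\<close> rewrites
  from the state \<open>H\<close>; \<pi> sends the pair of \<open>C\<close> and \<open>x\<close> to
  the Schreier generator of this edge. Along a word the Schreier generators telescope, whence \<pi>
  undoes \<open>s\<close>.\<close>

lemma finite_index_subgroup_retract:
  fixes X :: "'a set"
  defines "F \<equiv> free_group X"
  assumes "finite X" "subgroup H F" "finite (rcosets\<^bsub>F\<^esub> H)"
  obtains Y :: "nat set" and \<pi> s
  where "finite Y" "\<pi> \<in> hom (free_group Y) (F\<lparr>carrier := H\<rparr>)"
    "s \<in> hom (F\<lparr>carrier := H\<rparr>) (free_group Y)" "\<And>h. h \<in> H \<Longrightarrow> \<pi> (s h) = h"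
proof -
  interpret F: group F unfolding F_def by (rule group_free_group)
  interpret H: subgroup H F by fact
  let ?S = "rcosets\<^bsub>F\<^esub> H"
  let ?\<delta> = "\<lambda>C a. C #>\<^bsub>F\<^esub> [a]"
  \<comment> \<open>Natural numbers are used as letters because
    \<open>invariantly_finitely_L_presented\<close> asks for an alphabet of that type.\<close>
  obtain e :: "'a word set \<times> 'a \<Rightarrow> nat" where e: "inj_on e (?S \<times> X)"
    using finite_imp_inj_to_nat_seg[OF finite_cartesian_product[OF assms(4,2)]] by blast
  define Y where "Y = e ` (?S \<times> X)"
  let ?A = "F\<lparr>carrier := H\<rparr>"
  interpret A: group ?A by (rule F.subgroup_imp_group) fact
  interpret Y: group "free_group Y" by (rule group_free_group)
  have S_mult: "C #>\<^bsub>F\<^esub> g \<in> ?S"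
    and S_assoc: "h \<in> carrier F \<Longrightarrow> C #>\<^bsub>F\<^esub> g #>\<^bsub>F\<^esub> h = C #>\<^bsub>F\<^esub> (g \<otimes>\<^bsub>F\<^esub> h)"
    and S_one: "C #>\<^bsub>F\<^esub> [] = C"
    if C: "C \<in> ?S" and g: "g \<in> carrier F" for C g h
  proof -
    obtain c where c: "c \<in> carrier F" "C = H #>\<^bsub>F\<^esub> c" using C by (auto simp: RCOSETS_def)
    show "C #>\<^bsub>F\<^esub> g \<in> ?S"
      using c g F.coset_mult_assoc[OF H.subset] by (auto simp: RCOSETS_def)
    have "C \<subseteq> carrier F" using c F.r_coset_subset_G[OF H.subset] by simp
    then show "h \<in> carrier F \<Longrightarrow> C #>\<^bsub>F\<^esub> g #>\<^bsub>F\<^esub> h = C #>\<^bsub>F\<^esub> (g \<otimes>\<^bsub>F\<^esub> h)"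
      "C #>\<^bsub>F\<^esub> [] = C"
      using g F.coset_mult_one[of C]
      by (simp_all add: F.coset_mult_assoc one_free_group[of X, folded F_def])
  qed
  have letter_F: "[a] \<in> carrier F \<longleftrightarrow> fst a \<in> X" for a
    unfolding F_def by (rule letter_in_free_group)
  have inv_letter: "inv\<^bsub>F\<^esub> [a] = [inv_letter a]" if "fst a \<in> X" for a
    unfolding F_def by (rule inv_letter_free_group[OF that])
  have mult_letter: "[a] \<otimes>\<^bsub>F\<^esub> w = push_letter a w" for a w
    by (simp add: F_def free_group_def)
  have \<delta>_inv: "?\<delta> (?\<delta> C a) (inv_letter a) = C" if "C \<in> ?S" "fst a \<in> X" for C a
    using that S_assoc[of C "[a]" "inv\<^bsub>F\<^esub> [a]"] S_one[of C "[a]"]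
    by (simp add: letter_F inv_letter[symmetric]) (simp add: one_free_group[of X, folded F_def])
  have rw_closed: "rewrite ?\<delta> e C w \<in> carrier (free_group Y)"
    if "C \<in> ?S" "w \<in> carrier F" for C w
    using that(2,1)
  proof (induction w arbitrary: C)
    case (Cons a w)
    note D = Cons_in_free_groupD[OF Cons.prems(1)[unfolded F_def], folded F_def]
    let ?b = "(e (if snd a then C else ?\<delta> C a, fst a), snd a)"
    have \<delta>: "?\<delta> C a \<in> ?S" using Cons.prems(2) D(1) by (simp add: S_mult letter_F)
    have b: "[?b] \<in> carrier (free_group Y)"
      using Cons.prems(2) D(1) \<delta> by (auto simp: letter_in_free_group Y_def)
    have "rewrite ?\<delta> e C (a # w) = [?b] \<otimes>\<^bsub>free_group Y\<^esub> rewrite ?\<delta> e (?\<delta> C a) w"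
      by (simp add: free_group_def)
    then show ?case using b Cons.IH[OF D(2) \<delta>] by (simp del: rewrite.simps)
  qed (simp add: free_group_def)
  have rw_letter: "rewrite ?\<delta> e C ([a] \<otimes>\<^bsub>F\<^esub> w)
      = rewrite ?\<delta> e C [a] \<otimes>\<^bsub>free_group Y\<^esub> rewrite ?\<delta> e (?\<delta> C a) w"
    if "C \<in> ?S" "fst a \<in> X" for C a w
    unfolding mult_letter rewrite_push_letter[of ?\<delta>, OF \<delta>_inv[OF that]]
    by (simp add: free_group_def)
  \<comment> \<open>A cocycle rule: the second factor is rewritten from the state in which the first
    one ends. An element of \<open>H\<close> leads from the state \<open>H\<close> back to
    \<open>H\<close>, so on \<open>H\<close> the rule becomes multiplicativity.\<close>
  have rw_mult: "rewrite ?\<delta> e C (u \<otimes>\<^bsub>F\<^esub> v)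
      = rewrite ?\<delta> e C u \<otimes>\<^bsub>free_group Y\<^esub> rewrite ?\<delta> e (C #>\<^bsub>F\<^esub> u) v"
    if "C \<in> ?S" "u \<in> carrier F" and v: "v \<in> carrier F" for C u v
    using that(2,1) unfolding F_def
  proof (induction arbitrary: C rule: free_group_induct)
    case one
    then show ?case
      using S_one[OF _ v] by (simp add: F_def free_group_def)
  next
    case (letter a w)
    note IH = letter(3)[folded F_def] and prems = letter(1,2,4)[folded F_def]
    have a: "[a] \<in> carrier F" using prems by (simp add: letter_F)
    have \<delta>: "?\<delta> C a \<in> ?S" by (rule S_mult[OF prems(3) a])
    have "rewrite ?\<delta> e C ([a] \<otimes>\<^bsub>F\<^esub> w \<otimes>\<^bsub>F\<^esub> v)
        = rewrite ?\<delta> e C [a] \<otimes>\<^bsub>free_group Y\<^esub> (rewrite ?\<delta> e (?\<delta> C a) w \<otimes>\<^bsub>free_group Y\<^esub>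
            rewrite ?\<delta> e (?\<delta> C a #>\<^bsub>F\<^esub> w) v)"
      using prems a v by (simp add: F.m_assoc rw_letter IH[OF \<delta>])
    then show ?case
      unfolding F_def[symmetric]
      using prems a v rw_closed[OF prems(3) a] rw_closed[OF \<delta> prems(2)]
        rw_closed[OF S_mult[OF \<delta> prems(2)] v]
      by (simp add: rw_letter S_assoc Y.m_assoc del: rewrite.simps)
  qed
  \<comment> \<open>The trivial coset gets the representative \<open>\<one>\<close>, so that
    \<open>gen H h = h\<close> for \<open>h\<close> in \<open>H\<close>. Any other choice would give
    a conjugate of \<open>h\<close> at the end.\<close>
  define rep where "rep C = (if C = H then \<one>\<^bsub>F\<^esub> else SOME g. g \<in> carrier F \<and> C = H #>\<^bsub>F\<^esub> g)" for C
  have rep: "rep C \<in> carrier F" "H #>\<^bsub>F\<^esub> rep C = C" if "C \<in> ?S" for C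
  proof -
    have "\<exists>g. g \<in> carrier F \<and> C = H #>\<^bsub>F\<^esub> g" using that by (auto simp: RCOSETS_def)
    from someI_ex[OF this] show "rep C \<in> carrier F" "H #>\<^bsub>F\<^esub> rep C = C"
      by (auto simp: rep_def F.coset_mult_one H.subset)
  qed
  define gen where "gen C w = rep C \<otimes>\<^bsub>F\<^esub> w \<otimes>\<^bsub>F\<^esub> inv\<^bsub>F\<^esub> rep (C #>\<^bsub>F\<^esub> w)" for C w
  have gen: "gen C w \<in> H" if C: "C \<in> ?S" and w: "w \<in> carrier F" for C w
  proof -
    have "H #>\<^bsub>F\<^esub> (rep C \<otimes>\<^bsub>F\<^esub> w) = C #>\<^bsub>F\<^esub> w"
      using F.coset_mult_assoc[OF H.subset rep(1)[OF C] w] rep(2)[OF C] by simp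
    then have "rep C \<otimes>\<^bsub>F\<^esub> w \<in> H #>\<^bsub>F\<^esub> rep (C #>\<^bsub>F\<^esub> w)"
      using F.rcos_self[OF F.m_closed[OF rep(1)[OF C] w] H.subgroup_axioms] rep(2)[OF S_mult[OF C w]]
      by simp
    then show ?thesis
      using rep(1)[OF C] w rep(1)[OF S_mult[OF C w]]
        H.rcos_module_imp[OF F.is_group rep(1)[OF S_mult[OF C w]]] by (simp add: gen_def)
  qed
  define \<pi> where "\<pi> = free_lift ?A (\<lambda>n. case inv_into (?S \<times> X) e n of (C, x) \<Rightarrow> gen C [(x, True)])"
  have \<pi>: "\<pi> \<in> hom (free_group Y) ?A"
    unfolding \<pi>_def
  proof (rule free_lift_hom[OF A.is_group])
    fix n assume "n \<in> Y"
    then obtain C x where "C \<in> ?S" "x \<in> X" "n = e (C, x)" unfolding Y_def by auto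
    then show "(case inv_into (?S \<times> X) e n of (C, x) \<Rightarrow> gen C [(x, True)]) \<in> carrier ?A"
      by (simp add: inv_into_f_f[OF e] gen letter_F)
  qed
  interpret pi: group_hom "free_group Y" ?A \<pi> by unfold_locales (rule \<pi>)
  have pi_gen: "\<pi> [(e (C, x), True)] = gen C [(x, True)]" if "C \<in> ?S" "x \<in> X" for C x
    using that unfolding \<pi>_def
    by (subst free_lift_letter[OF A.is_group]) (simp_all add: inv_into_f_f[OF e] gen letter_F)
  have pi_letter: "\<pi> (rewrite ?\<delta> e C [a]) = gen C [a]" if C: "C \<in> ?S" and a: "fst a \<in> X" for C a
  proof (cases "snd a")
    case True
    then show ?thesis using that pi_gen[of C "fst a"] by (cases a) auto
  next
    case False
    then obtain x where a': "a = (x, False)" by (cases a) auto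
    then have x: "x \<in> X" and inv: "[(x, False)] = inv\<^bsub>F\<^esub> [(x, True)]"
      using a inv_letter[of "(x, True)"] by (auto simp: inv_letter_def)
    have xF: "[(x, True)] \<in> carrier F" "[(x, False)] \<in> carrier F" using x by (simp_all add: letter_F)
    \<comment> \<open>Reading the inverse of \<open>x\<close> in state \<open>C\<close> runs
      backwards along the edge from \<open>D\<close> to \<open>C\<close>. The output letter is the
      inverse of the one for \<open>D\<close> and \<open>x\<close>, and its value is the inverse of
      the Schreier generator of that edge.\<close>
    define D where "D = C #>\<^bsub>F\<^esub> [(x, False)]"
    have D: "D \<in> ?S" "D #>\<^bsub>F\<^esub> [(x, True)] = C"
      unfolding D_def using S_mult[OF C xF(2)] \<delta>_inv[OF C, of "(x, False)"] x
      by (auto simp: inv_letter_def)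
    have Dx: "[(e (D, x), True)] \<in> carrier (free_group Y)"
      using D x by (auto simp: letter_in_free_group Y_def)
    have "rewrite ?\<delta> e C [a] = inv\<^bsub>free_group Y\<^esub> [(e (D, x), True)]"
      using D x by (subst inv_letter_free_group) (auto simp: a' D_def Y_def inv_letter_def)
    then have "\<pi> (rewrite ?\<delta> e C [a]) = inv\<^bsub>F\<^esub> gen D [(x, True)]"
      using Dx gen[OF D(1) xF(1)] pi_gen[OF D(1) x] by (simp add: F.m_inv_consistent[OF assms(3)])
    also have "\<dots> = rep C \<otimes>\<^bsub>F\<^esub> [(x, False)] \<otimes>\<^bsub>F\<^esub> inv\<^bsub>F\<^esub> rep D"
      using rep(1)[OF C] rep(1)[OF D(1)] xF
      by (simp add: gen_def D(2) F.inv_mult_group F.m_assoc inv)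
    also have "\<dots> = gen C [a]" by (simp add: gen_def a' D_def)
    finally show ?thesis .
  qed
  have pi_rw: "\<pi> (rewrite ?\<delta> e C w) = gen C w" if C: "C \<in> ?S" and w: "w \<in> carrier F" for C w
    using w C unfolding F_def
  proof (induction arbitrary: C rule: free_group_induct)
    case one
    have "gen C [] = \<one>\<^bsub>F\<^esub>"
      using S_one[OF one(1)[folded F_def] F.one_closed] rep(1)[OF one(1)[folded F_def]]
        F.r_one[OF rep(1)[OF one(1)[folded F_def]]]
      by (simp add: gen_def one_free_group[of X, folded F_def])
    then show ?case using pi.hom_one by (simp add: one_free_group)
  next
    case (letter a w)
    note IH = letter(3)[folded F_def] and prems = letter(1,2,4)[folded F_def]
    have a: "[a] \<in> carrier F" using prems by (simp add: letter_F)
    have \<delta>: "?\<delta> C a \<in> ?S" by (rule S_mult[OF prems(3) a])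
    have "\<pi> (rewrite ?\<delta> e C ([a] \<otimes>\<^bsub>F\<^esub> w)) = gen C [a] \<otimes>\<^bsub>F\<^esub> gen (?\<delta> C a) w"
      using rw_closed[OF prems(3) a] rw_closed[OF \<delta> prems(2)] prems
      by (simp add: rw_letter pi_letter IH[OF \<delta>] del: rewrite.simps)
    \<comment> \<open>The telescoping: the representative of the intermediate coset
      \<open>C #> [a]\<close> cancels between the two factors.\<close>
    also have "\<dots> = gen C ([a] \<otimes>\<^bsub>F\<^esub> w)"
    proof -
      have "inv\<^bsub>F\<^esub> rep (?\<delta> C a) \<otimes>\<^bsub>F\<^esub> (rep (?\<delta> C a) \<otimes>\<^bsub>F\<^esub> z) = z" if "z \<in> carrier F" for z
        using that rep(1)[OF \<delta>] by (simp add: F.m_assoc[symmetric])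
      then show ?thesis
        using a prems rep(1)[OF prems(3)] rep(1)[OF \<delta>] rep(1)[OF S_mult[OF \<delta> prems(2)]]
        by (simp add: gen_def S_assoc F.m_assoc)
    qed
    finally show ?case unfolding F_def .
  qed
  have H_S: "H \<in> ?S" by (rule H.subgroup_in_rcosets[OF F.is_group])
  have H_mult: "H #>\<^bsub>F\<^esub> h = H" if "h \<in> H" for h
    using that by (intro F.coset_join2) (auto simp: H.subgroup_axioms)
  show thesis
  proof (rule that)
    show "finite Y" unfolding Y_def using assms(2,4) by blast
    show "rewrite ?\<delta> e H \<in> hom ?A (free_group Y)"
      by (auto simp: hom_def rw_closed[OF H_S] rw_mult[OF H_S] H_mult)
    show "\<pi> (rewrite ?\<delta> e H h) = h" if "h \<in> H" for h
      using that pi_rw[OF H_S, of h] by (simp add: gen_def H_mult rep_def)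
  qed (rule \<pi>)
qed

subsection \<open>Weakly leaf-invariant subgroups\<close>

text \<open>Removing letters from the left until the rest lies in \<open>V\<close> yields the
  longest suffix \<delta> in \<open>V\<close>; \<psi> is the last letter removed. The process ends
  because the empty word is in \<open>V\<close>.\<close>

lemma not_mem_suffix_split:
  assumes "[] \<in> V" "\<sigma> \<notin> V"
  obtains \<tau> \<psi> \<delta> where "\<sigma> = \<tau> @ \<psi> # \<delta>" "\<delta> \<in> V" "\<psi> # \<delta> \<notin> V"
  using assms(2)
proof (induction \<sigma> arbitrary: thesis)
  case (Cons a \<sigma>)
  show ?case
  proof (cases "\<sigma> \<in> V")
    case True
    then show ?thesis using Cons.prems(1)[of "[]" a \<sigma>] Cons.prems(2) by simp
  next
    case False
    then show ?thesis using Cons.IH Cons.prems(1) by (metis append_Cons)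
  qed
qed (use assms(1) in simp)

text \<open>Blocks are split off at the right end until the remainder \<open>v\<close> lies in
  \<open>V\<close>. As the head of a word acts first, \<open>v\<close> acts directly on the relators
  and the blocks act afterwards.\<close>

lemma suffix_decomposition:
  assumes "[] \<in> V" "\<sigma> \<in> lists \<Phi>"
  shows "\<exists>v\<in>V. \<exists>ws \<in> lists {\<psi> # \<delta> | \<psi> \<delta>. \<psi> \<in> \<Phi> \<and> \<delta> \<in> V \<and> \<psi> # \<delta> \<notin> V}. \<sigma> = v @ concat ws"
  using assms(2)
proof (induction "length \<sigma>" arbitrary: \<sigma> rule: less_induct)
  case less
  show ?case
  proof (cases "\<sigma> \<in> V")
    case True
    then show ?thesis by (intro bexI[of _ \<sigma>] bexI[of _ "[]"]) auto
  next
    case False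
    then obtain \<tau> \<psi> \<delta> where \<sigma>: "\<sigma> = \<tau> @ \<psi> # \<delta>" "\<delta> \<in> V" "\<psi> # \<delta> \<notin> V"
      using not_mem_suffix_split[OF assms(1)] by blast
    obtain v ws where *: "v \<in> V" "\<tau> = v @ concat ws"
      "ws \<in> lists {\<psi> # \<delta> | \<psi> \<delta>. \<psi> \<in> \<Phi> \<and> \<delta> \<in> V \<and> \<psi> # \<delta> \<notin> V}"
      using less.hyps[of \<tau>] less.prems \<sigma>(1) by auto
    show ?thesis
    proof (intro bexI)
      show "\<sigma> = v @ concat (ws @ [\<psi> # \<delta>])" using \<sigma>(1) *(2) by simp
      show "ws @ [\<psi> # \<delta>] \<in> lists {\<psi> # \<delta> | \<psi> \<delta>. \<psi> \<in> \<Phi> \<and> \<delta> \<in> V \<and> \<psi> # \<delta> \<notin> V}"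
        using *(3) \<sigma> less.prems by auto
    qed (rule *(1))
  qed
qed

lemma act_concat: "act (concat ws) x = act (map act ws) x"
  by (induction ws arbitrary: x) auto

section \<open>The full preimage of a normal subgroup of finite index\<close>

lemma L_kernel_normal:
  assumes "finite_L_presentation L"
  shows "L_kernel L \<lhd> free_group (alphabet L)"
proof -
  have "endos L \<subseteq> hom (free_group (alphabet L)) (free_group (alphabet L))"
    using assms by (auto simp: finite_L_presentation_def endomorphisms_def)
  then show ?thesis
    unfolding L_kernel_def using assms orbit_subset[of "endos L" "free_group (alphabet L)" "iter_rels L"]
    by (intro normal_normal_closure group_free_group) (auto simp: finite_L_presentation_def)
qed

text \<open>For normal \<open>H\<close> the coset \<open>C #> g\<close> is the product of
  \<open>C\<close> and \<open>H #> g\<close> in the quotient, so it depends on \<open>g\<close> only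
  through its coset.\<close>

lemma normal_coset_rep_cong:
  assumes "H \<lhd> G" "g \<in> carrier G" "g' \<in> carrier G" "H #>\<^bsub>G\<^esub> g = H #>\<^bsub>G\<^esub> g'"
  shows "coset_rep G H g = coset_rep G H g'"
  unfolding coset_rep_def
proof (rule restrict_ext)
  fix C assume "C \<in> rcosets\<^bsub>G\<^esub> H"
  then obtain c where c: "c \<in> carrier G" "C = H #>\<^bsub>G\<^esub> c" by (auto simp: RCOSETS_def)
  interpret H: normal H G by fact
  have "C #>\<^bsub>G\<^esub> x = (H #>\<^bsub>G\<^esub> c) <#>\<^bsub>G\<^esub> (H #>\<^bsub>G\<^esub> x)" if "x \<in> carrier G" for x
    using c that by (simp add: H.rcos_sum H.coset_mult_assoc[OF H.subset])
  then show "C #>\<^bsub>G\<^esub> g = C #>\<^bsub>G\<^esub> g'" using assms by simp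
qed

lemma full_preimage_normal:
  assumes "finite_L_presentation L" "U \<lhd> L_group L"
  shows "full_preimage L U \<lhd> free_group (alphabet L)"
proof -
  let ?F = "free_group (alphabet L)"
  interpret K: normal "L_kernel L" ?F by (rule L_kernel_normal[OF assms(1)])
  have "group_hom ?F (?F Mod L_kernel L) (\<lambda>g. L_kernel L #>\<^bsub>?F\<^esub> g)"
    by (simp add: group_hom_def group_hom_axioms_def K.is_group K.factorgroup_is_group K.r_coset_hom_Mod)
  from normal_vimage[OF this assms(2)[unfolded L_group_def]] show ?thesis
    by (simp add: full_preimage_def)
qed

text \<open>The preimage is the kernel of the composite map from the free group to
  \<open>L_group L Mod U\<close>, so its quotient embeds into that finite group.\<close>

lemma finite_rcosets_full_preimage:
  assumes "finite_L_presentation L" "U \<lhd> L_group L" "finite (rcosets\<^bsub>L_group L\<^esub> U)"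
  shows "finite (rcosets\<^bsub>free_group (alphabet L)\<^esub> full_preimage L U)"
proof -
  let ?F = "free_group (alphabet L)"
  let ?G = "L_group L"
  let ?q = "\<lambda>g. L_kernel L #>\<^bsub>?F\<^esub> g"
  interpret K: normal "L_kernel L" ?F by (rule L_kernel_normal[OF assms(1)])
  interpret U: normal U ?G by fact
  have q: "?q \<in> hom ?F ?G" unfolding L_group_def by (rule K.r_coset_hom_Mod)
  have "(\<lambda>x. U #>\<^bsub>?G\<^esub> x) \<circ> ?q \<in> hom ?F (?G Mod U)"
    by (rule hom_compose[OF q U.r_coset_hom_Mod])
  then interpret p: group_hom ?F "?G Mod U" "\<lambda>g. U #>\<^bsub>?G\<^esub> ?q g"
    by (simp add: group_hom_def group_hom_axioms_def K.is_group U.factorgroup_is_group comp_def)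
  have "U #>\<^bsub>?G\<^esub> x = U \<longleftrightarrow> x \<in> U" if "x \<in> carrier ?G" for x
    using U.coset_join1[OF _ that U.subgroup_axioms] U.coset_join2[OF that U.subgroup_axioms] by blast
  then have "kernel ?F (?G Mod U) (\<lambda>g. U #>\<^bsub>?G\<^esub> ?q g) = full_preimage L U"
    unfolding kernel_def full_preimage_def one_FactGroup
    using hom_in_carrier[OF q] by (intro Collect_cong conj_cong refl) blast
  then have "inj_on (\<lambda>X. the_elem ((\<lambda>g. U #>\<^bsub>?G\<^esub> ?q g) ` X)) (carrier (?F Mod full_preimage L U))"
    and "(\<lambda>X. the_elem ((\<lambda>g. U #>\<^bsub>?G\<^esub> ?q g) ` X)) ` carrier (?F Mod full_preimage L U)
      \<subseteq> carrier (?G Mod U)"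
    using p.FactGroup_inj_on p.FactGroup_the_elem_mem by auto
  then have "finite (carrier (?F Mod full_preimage L U))"
    using assms(3) by (auto intro: inj_on_finite simp: FactGroup_def)
  then show ?thesis by (simp add: FactGroup_def)
qed

text \<open>An equality and not only an isomorphism: \<open>U\<close> is itself a set of cosets of
  the kernel, and \<open>set_mult\<close> reads the multiplication but not the carrier.\<close>

lemma L_group_full_preimage:
  assumes "U \<lhd> L_group L"
  shows "(L_group L)\<lparr>carrier := U\<rparr>
    = (free_group (alphabet L))\<lparr>carrier := full_preimage L U\<rparr> Mod L_kernel L"
proof -
  interpret U: normal U "L_group L" by fact
  have "U \<subseteq> (\<lambda>g. L_kernel L #>\<^bsub>free_group (alphabet L)\<^esub> g) ` carrier (free_group (alphabet L))"
    using U.subset by (simp add: L_group_def carrier_FactGroup)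
  moreover have "set_mult (F\<lparr>carrier := S\<rparr>) = set_mult F" for F :: "'a word monoid" and S
    by (intro ext) (simp add: set_mult_def)
  ultimately show ?thesis
    by (auto simp: L_group_def FactGroup_def RCOSETS_def full_preimage_def r_coset_def)
qed

lemma L_kernel_subset_full_preimage:
  assumes "finite_L_presentation L" "U \<lhd> L_group L"
  shows "L_kernel L \<subseteq> full_preimage L U"
proof
  fix k assume k: "k \<in> L_kernel L"
  interpret K: normal "L_kernel L" "free_group (alphabet L)" by (rule L_kernel_normal[OF assms(1)])
  interpret U: normal U "L_group L" by fact
  have "L_kernel L #>\<^bsub>free_group (alphabet L)\<^esub> k = \<one>\<^bsub>L_group L\<^esub>"
    using K.coset_join2[OF K.mem_carrier[OF k] K.subgroup_axioms k] by (simp add: L_group_def)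
  then show "k \<in> full_preimage L U"
    using U.one_closed K.mem_carrier[OF k] by (simp add: full_preimage_def)
qed

section \<open>Finiteness of \<open>V\<close> and endomorphisms of the preimage\<close>

text \<open>By normality the homomorphism induced by \<sigma> is determined by the cosets of the
  images of the generators, and there are finitely many functions from generators to cosets.
  Distinct least words induce distinct homomorphisms, as otherwise each would precede the
  other.\<close>

lemma finite_least_words:
  assumes L: "finite_L_presentation L" and "strict_linear_order_on (endos L) r"
    and "U \<lhd> L_group L" "finite (rcosets\<^bsub>L_group L\<^esub> U)"
  shows "finite (least_words L r U)"
proof -
  let ?X = "alphabet L"
  let ?F = "free_group ?X"
  let ?H = "full_preimage L U"
  interpret H: normal ?H ?F by (rule full_preimage_normal[OF L assms(3)])
  define \<theta> where "\<theta> \<sigma> = (\<lambda>x\<in>?X. ?H #>\<^bsub>?F\<^esub> act \<sigma> [(x, True)])" for \<sigma>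
  have "asym (word_order r)"
    using assms(2) unfolding word_order_eq_lenlex strict_linear_order_on_def
    by (intro asym_inv_image asym_lenlex) (simp add: asym_on_iff_irrefl_on_if_trans_on)
  then have asymD: "(\<sigma>, \<delta>) \<in> word_order r \<Longrightarrow> (\<delta>, \<sigma>) \<notin> word_order r" for \<sigma> \<delta>
    by (auto dest: asymD)
  have act: "act \<sigma> \<in> hom ?F ?F" if "\<sigma> \<in> least_words L r U" for \<sigma>
    using that L
    by (intro act_hom[of _ "endos L"])
       (auto simp: least_words_def finite_L_presentation_def endomorphisms_def)
  have "inj_on \<theta> (least_words L r U)"
  proof (rule inj_onI)
    fix \<sigma> \<delta> assume V: "\<sigma> \<in> least_words L r U" "\<delta> \<in> least_words L r U" and eq: "\<theta> \<sigma> = \<theta> \<delta>"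
    have hom: "(\<lambda>g. ?H #>\<^bsub>?F\<^esub> act \<tau> g) \<in> hom ?F (?F Mod ?H)" if "\<tau> \<in> least_words L r U" for \<tau>
      using hom_compose[OF act[OF that] H.r_coset_hom_Mod] by (simp add: comp_def)
    have gen: "?H #>\<^bsub>?F\<^esub> act \<sigma> [(x, True)] = ?H #>\<^bsub>?F\<^esub> act \<delta> [(x, True)]" if "x \<in> ?X" for x
      using fun_cong[OF eq, of x] that by (simp add: \<theta>_def)
    have "?H #>\<^bsub>?F\<^esub> act \<sigma> g = ?H #>\<^bsub>?F\<^esub> act \<delta> g" if "g \<in> carrier ?F" for g
      by (rule free_group_hom_eq[OF hom[OF V(1)] hom[OF V(2)] H.factorgroup_is_group gen that])
    then have "word_rep L U \<sigma> = word_rep L U \<delta>"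
      unfolding word_rep_def
      by (intro restrict_ext normal_coset_rep_cong H.normal_axioms
          hom_in_carrier[OF act[OF V(1)]] hom_in_carrier[OF act[OF V(2)]])
    then show "\<sigma> = \<delta>"
      using V asymD[of \<sigma> \<delta>] unfolding least_words_def mem_Collect_eq by metis
  qed
  moreover have "\<theta> ` least_words L r U \<subseteq> ?X \<rightarrow>\<^sub>E rcosets\<^bsub>?F\<^esub> ?H"
  proof (intro image_subsetI)
    fix \<sigma> assume V: "\<sigma> \<in> least_words L r U"
    have "act \<sigma> [(x, True)] \<in> carrier ?F" if "x \<in> ?X" for x
      using that by (intro hom_in_carrier[OF act[OF V]]) (simp add: letter_in_free_group)
    then show "\<theta> \<sigma> \<in> ?X \<rightarrow>\<^sub>E rcosets\<^bsub>?F\<^esub> ?H"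
      unfolding \<theta>_def using H.rcosetsI[OF H.subset] by auto
  qed
  moreover have "finite (?X \<rightarrow>\<^sub>E rcosets\<^bsub>?F\<^esub> ?H)"
    using L finite_rcosets_full_preimage[OF L assms(3,4)]
    by (intro finite_PiE) (auto simp: finite_L_presentation_def)
  ultimately show ?thesis by (rule inj_on_finite)
qed

text \<open>An element of the normal preimage acts trivially on the cosets, just as
  \<open>\<one>\<close> does. Since the representation of \<sigma> factors through that of the empty
  word, \<open>act \<sigma> h\<close> acts trivially too; in particular it fixes the coset
  \<open>full_preimage L U\<close>.\<close>

lemma leads_to_Nil_preserves_full_preimage:
  assumes L: "finite_L_presentation L" and "U \<lhd> L_group L" "\<sigma> \<in> lists (endos L)"
    and "leads_to L U \<sigma> []" "h \<in> full_preimage L U"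
  shows "act \<sigma> h \<in> full_preimage L U"
proof -
  let ?F = "free_group (alphabet L)"
  let ?H = "full_preimage L U"
  interpret H: normal ?H ?F by (rule full_preimage_normal[OF L assms(2)])
  have "act \<sigma> \<in> hom ?F ?F"
    using L assms(3)
    by (intro act_hom[of _ "endos L"]) (auto simp: finite_L_presentation_def endomorphisms_def)
  then interpret \<sigma>: group_hom ?F ?F "act \<sigma>" by unfold_locales
  have h: "h \<in> carrier ?F" using assms(5) by simp
  have "?H #>\<^bsub>?F\<^esub> h = ?H #>\<^bsub>?F\<^esub> \<one>\<^bsub>?F\<^esub>"
    using H.coset_join2[OF h H.subgroup_axioms assms(5)] H.coset_mult_one[OF H.subset] by simp
  then have "word_rep L U [] h = word_rep L U [] \<one>\<^bsub>?F\<^esub>"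
    using normal_coset_rep_cong[OF H.normal_axioms h H.one_closed] h
    by (simp add: word_rep_def)
  then have eq: "word_rep L U \<sigma> h = word_rep L U \<sigma> \<one>\<^bsub>?F\<^esub>"
    using assms(4) h unfolding leads_to_def by (metis H.one_closed)
  have "?H \<in> rcosets\<^bsub>?F\<^esub> ?H" by (rule H.subgroup_in_rcosets[OF H.is_group])
  with fun_cong[OF eq, of ?H] have "?H #>\<^bsub>?F\<^esub> act \<sigma> h = ?H"
    using h H.coset_mult_one[OF H.subset] by (simp add: word_rep_def coset_rep_def)
  then show ?thesis using H.rcos_self[OF \<sigma>.hom_closed[OF h] H.subgroup_axioms] by simp
qed

text \<open>The letters \<open>a\<close> range over generators and formal inverses, so conjugation
  by any element is a composite of the given conjugations.\<close>

lemma conj_invariant_imp_normal: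
  assumes "subgroup N (free_group X)"
    and conj: "\<And>a k. fst a \<in> X \<Longrightarrow> k \<in> N \<Longrightarrow>
      [a] \<otimes>\<^bsub>free_group X\<^esub> k \<otimes>\<^bsub>free_group X\<^esub> inv\<^bsub>free_group X\<^esub> [a] \<in> N"
  shows "N \<lhd> free_group X"
proof -
  let ?F = "free_group X"
  interpret F: group ?F by (rule group_free_group)
  interpret N: subgroup N ?F by fact
  have "\<forall>k\<in>N. g \<otimes>\<^bsub>?F\<^esub> k \<otimes>\<^bsub>?F\<^esub> inv\<^bsub>?F\<^esub> g \<in> N" if "g \<in> carrier ?F" for g
    using that
  proof (induction rule: free_group_induct)
    case one
    show ?case using F.l_one F.r_one F.inv_one by (simp add: one_free_group[of X, symmetric])
  next
    case (letter a w)
    then have "[a] \<in> carrier ?F" by (simp add: letter_in_free_group)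
    then have "([a] \<otimes>\<^bsub>?F\<^esub> w) \<otimes>\<^bsub>?F\<^esub> k \<otimes>\<^bsub>?F\<^esub> inv\<^bsub>?F\<^esub> ([a] \<otimes>\<^bsub>?F\<^esub> w)
        = [a] \<otimes>\<^bsub>?F\<^esub> (w \<otimes>\<^bsub>?F\<^esub> k \<otimes>\<^bsub>?F\<^esub> inv\<^bsub>?F\<^esub> w) \<otimes>\<^bsub>?F\<^esub> inv\<^bsub>?F\<^esub> [a]" if "k \<in> N" for k
      using that letter(2) by (simp add: F.inv_mult_group F.m_assoc)
    then show ?case using letter conj by simp
  qed
  then show ?thesis unfolding F.normal_inv_iff using assms(1) by blast
qed

theorem theorem7p6:
  fixes L :: "'a L_presentation"
    and r :: "(('a word \<Rightarrow> 'a word) \<times> ('a word \<Rightarrow> 'a word)) set"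
    and U :: "'a word set set"
  assumes "finite_L_presentation L"
    and "invariant_L_presentation L"
    and "strict_linear_order_on (endos L) r"
    and "U \<lhd> L_group L"
    and "finite (rcosets\<^bsub>L_group L\<^esub> U)"
    and "weakly_leaf_invariant L r U"
  shows "invariantly_finitely_L_presented ((L_group L)\<lparr>carrier := U\<rparr>)"
proof -
  let ?X = "alphabet L"
  let ?F = "free_group ?X"
  let ?H = "full_preimage L U"
  let ?A = "?F\<lparr>carrier := ?H\<rparr>"
  define V where "V = least_words L r U"
  define W where "W = {\<psi> # \<delta> | \<psi> \<delta>. \<psi> \<in> endos L \<and> \<delta> \<in> V \<and> \<psi> # \<delta> \<notin> V}"
  \<comment> \<open>Normal closures in \<open>?A\<close> are only closed under conjugation by the
    preimage. Taking conjugation by letters of both signs into \<Phi> makes the closure normal in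
    the whole free group.\<close>
  define conj where "conj a g = [a] \<otimes>\<^bsub>?F\<^esub> g \<otimes>\<^bsub>?F\<^esub> inv\<^bsub>?F\<^esub> [a]" for a g
  define \<Phi> where "\<Phi> = act ` W \<union> conj ` (?X \<times> UNIV)"
  \<comment> \<open>Fixed and iterated relators are treated alike. The additional images of fixed
    relators stay in the kernel because the presentation is invariant.\<close>
  define R where "R = (\<Union>v\<in>V. act v ` (fixed_rels L \<union> iter_rels L))"
  let ?N = "normal_closure ?A (\<Union>\<sigma>\<in>lists \<Phi>. act \<sigma> ` R)"
  have fin: "finite ?X" "finite (fixed_rels L \<union> iter_rels L)" "finite (endos L)"
    and endos: "endos L \<subseteq> hom ?F ?F"
    using assms(1) by (auto simp: finite_L_presentation_def endomorphisms_def)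
  interpret F: group ?F by (rule group_free_group)
  interpret K: normal "L_kernel L" ?F by (rule L_kernel_normal[OF assms(1)])
  interpret H: normal ?H ?F by (rule full_preimage_normal[OF assms(1,4)])
  interpret A: group ?A by (rule F.subgroup_imp_group[OF H.subgroup_axioms])
  have K_H: "L_kernel L \<subseteq> ?H" by (rule L_kernel_subset_full_preimage[OF assms(1,4)])
  have V_lists: "V \<subseteq> lists (endos L)" and Nil_V: "[] \<in> V"
    by (auto simp: V_def least_words_def word_order_def)
  have finite_V: "finite V"
    unfolding V_def by (rule finite_least_words) (fact assms)+
  have W_lists: "W \<subseteq> lists (endos L)"
  proof
    fix w assume "w \<in> W"
    then obtain \<psi> \<delta> where "w = \<psi> # \<delta>" "\<psi> \<in> endos L" "\<delta> \<in> V" by (auto simp: W_def)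
    then show "w \<in> lists (endos L)" using subsetD[OF V_lists, of \<delta>] by simp
  qed
  have "W \<subseteq> (\<lambda>(\<psi>, \<delta>). \<psi> # \<delta>) ` (endos L \<times> V)" by (auto simp: W_def)
  then have "finite W" using fin(3) finite_V by (blast intro: finite_subset)
  then have finite_\<Phi>: "finite \<Phi>" using fin(1) by (simp add: \<Phi>_def)
  have finite_R: "finite R" using fin(2) finite_V by (simp add: R_def)
  \<comment> \<open>Here weak leaf-invariance enters: it turns the words in \<open>W\<close> into
    endomorphisms of \<open>?A\<close>.\<close>
  have W_H: "act w h \<in> ?H" if "w \<in> W" "h \<in> ?H" for w h
  proof (rule leads_to_Nil_preserves_full_preimage[OF assms(1,4)])
    show "w \<in> lists (endos L)" using that W_lists by blast
    show "leads_to L U w []"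
      using that assms(6) by (auto simp: W_def V_def weakly_leaf_invariant_def)
  qed (rule that(2))
  have K_act: "act \<sigma> k \<in> L_kernel L" if "\<sigma> \<in> lists (endos L)" "k \<in> L_kernel L" for \<sigma> k
    using act_closed[OF _ that] assms(2) by (auto simp: invariant_L_presentation_def)
  have \<Phi>_hom: "\<Phi> \<subseteq> hom ?A ?A"
  proof -
    have "act w \<in> hom ?A ?A" if "w \<in> W" for w
    proof -
      have "act w \<in> hom ?F ?F" using that W_lists endos by (blast intro: act_hom)
      then show ?thesis using W_H[OF that] H.mem_carrier by (auto simp: hom_def)
    qed
    moreover have "conj a \<in> hom ?A ?A" if "fst a \<in> ?X" for a
    proof -
      have a: "[a] \<in> carrier ?F" using that by (simp add: letter_in_free_group)
      have "inv\<^bsub>?F\<^esub> [a] \<otimes>\<^bsub>?F\<^esub> ([a] \<otimes>\<^bsub>?F\<^esub> z) = z" if "z \<in> carrier ?F" for z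
        using that a by (simp add: F.m_assoc[symmetric])
      then show ?thesis
        using a H.inv_op_closed2[OF a] by (auto simp: hom_def conj_def F.m_assoc)
    qed
    ultimately show ?thesis by (auto simp: \<Phi>_def)
  qed
  have K_rels: "fixed_rels L \<union> iter_rels L \<subseteq> L_kernel L"
  proof -
    have "iter_rels L \<subseteq> (\<Union>\<sigma>\<in>lists (endos L). act \<sigma> ` iter_rels L)"
      by (auto intro!: bexI[of _ "[]"])
    from order_trans[OF Un_mono[OF order_refl this] normal_closure_superset] show ?thesis
      unfolding L_kernel_def .
  qed
  have R_K: "R \<subseteq> L_kernel L" 
    unfolding R_def using K_act[OF subsetD[OF V_lists] subsetD[OF K_rels]] by auto
  have R_A: "R \<subseteq> carrier ?A" using R_K K_H by auto
  have "?N \<subseteq> L_kernel L"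
  proof (rule normal_closure_least)
    show "L_kernel L \<lhd> ?A"
      by (rule F.normal_restrict_supergroup[OF H.subgroup_axioms K.normal_axioms K_H])
    have "\<phi> k \<in> L_kernel L" if "\<phi> \<in> \<Phi>" "k \<in> L_kernel L" for \<phi> k
    proof -
      from that(1) consider w where "w \<in> W" "\<phi> = act w" | a where "fst a \<in> ?X" "\<phi> = conj a"
        by (auto simp: \<Phi>_def)
      then show ?thesis
      proof cases
        case 1
        then show ?thesis using K_act that(2) W_lists by blast
      next
        case 2
        then show ?thesis using K.inv_op_closed2 that(2) by (simp add: conj_def letter_in_free_group)
      qed
    qed
    then show "(\<Union>\<sigma>\<in>lists \<Phi>. act \<sigma> ` R) \<subseteq> L_kernel L"
      using act_closed[of \<Phi> "L_kernel L"] R_K by blast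
  qed
  moreover have "L_kernel L \<subseteq> ?N"
    unfolding L_kernel_def
  proof (rule normal_closure_least)
    have N: "?N \<lhd> ?A" by (intro normal_normal_closure A.is_group orbit_subset \<Phi>_hom R_A)
    show "?N \<lhd> ?F"
    proof (rule conj_invariant_imp_normal)
      show "subgroup ?N ?F"
        using F.incl_subgroup[OF H.subgroup_axioms] N normal_imp_subgroup by blast
      fix a :: "'a \<times> bool" and k assume "fst a \<in> ?X" "k \<in> ?N"
      then have "conj a \<in> \<Phi>" by (cases a) (auto simp: \<Phi>_def)
      then have "conj a k \<in> ?N"
        using normal_closure_orbit_invariant[OF A.is_group \<Phi>_hom R_A] \<open>k \<in> ?N\<close> by blast
      then show "[a] \<otimes>\<^bsub>?F\<^esub> k \<otimes>\<^bsub>?F\<^esub> inv\<^bsub>?F\<^esub> [a] \<in> ?N" by (simp add: conj_def)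
    qed
    have "act \<sigma> x \<in> ?N" if \<sigma>: "\<sigma> \<in> lists (endos L)" and x: "x \<in> fixed_rels L \<union> iter_rels L" for \<sigma> x
    proof -
      obtain v ws where "v \<in> V" and ws: "ws \<in> lists W" and "\<sigma> = v @ concat ws"
        using suffix_decomposition[OF Nil_V \<sigma>] unfolding W_def by blast
      then have "act \<sigma> x = act (map act ws) (act v x)" "act v x \<in> R"
        using x by (auto simp: act_concat R_def)
      moreover have "map act ws \<in> lists \<Phi>" using ws by (auto simp: \<Phi>_def)
      ultimately have "act \<sigma> x \<in> (\<Union>\<sigma>\<in>lists \<Phi>. act \<sigma> ` R)" by blast
      then show ?thesis by (rule subsetD[OF normal_closure_superset])
    qed
    \<comment> \<open>The empty word accounts for the fixed relators, arbitrary words for the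
      iterated ones.\<close>
    from this[of "[]"] this show "fixed_rels L \<union> (\<Union>\<sigma>\<in>lists (endos L). act \<sigma> ` iter_rels L) \<subseteq> ?N"
      by auto
  qed
  ultimately have "L_kernel L = ?N" by blast
  moreover obtain Y :: "nat set" and \<pi> s where "finite Y" "\<pi> \<in> hom (free_group Y) ?A"
    "s \<in> hom ?A (free_group Y)" "\<And>h. h \<in> ?H \<Longrightarrow> \<pi> (s h) = h"
    using finite_index_subgroup_retract[OF fin(1) H.subgroup_axioms
        finite_rcosets_full_preimage[OF assms(1,4,5)]] by blast
  then have "invariantly_finitely_L_presented (?A Mod ?N)"
    by (intro retract_invariantly_finitely_L_presented[of Y _ \<pi> s] A.is_group finite_\<Phi> \<Phi>_hom finite_R R_A)
       auto
  ultimately show ?thesis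
    by (simp add: L_group_full_preimage[OF assms(4)])
qed

end
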